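(* The following two statements are equivalent. (A) (Log-rank conjecture) There is a constant $C$ such that every function $f:\mathcal X\times\mathcal Y\to\{0,1\}$ (finite $\mathcal X,\mathcal Y$) with $\operatorname{rank}(f)\ge 2$ satisfies $\operatorname{CC}_{det}(f)\le C(\log\operatorname{rank}(f))^C$. (B) There is a constant $C$ such that for every $d\ge 2$ and every configuration $(\mathcal P,\mathcal H)$ in $\mathbb R^d$ with $n=|\mathcal P|$ points and $m=|\mathcal H|$ hyperplanes that admits a parallel $2$-partition and has offset set $\mathcal B(\mathcal H)=\{0,1\}$, we have $\operatorname{rs}(\mathcal P,\mathcal H)\ge mn\cdot 2^{-C(\log d)^C}$.
   Context: $\operatorname{CC}_{det}(f)$ is the deterministic two-party communication complexity of $f$ (minimum over protocols computing $f(x,y)$, Alice holding $x$ and Bob $y$, of the worst-case number of bits communicated); $\operatorname{rank}(f)$ is the real rank of the matrix $(f(x,y))_{x,y}$. Logarithms are base 2. A configuration is a finite set $\mathcal P$ of points and a finite set $\mathcal H$ of hyperplanes in $\mathbb R^d$; each hyperplane is written $\{x:\langle a,x\rangle=b\}$ with $a\ne0$, $b$ its offset, and $\mathcal B(\mathcal H)=\{b(h):h\in\mathcal H\}$. A parallel $k$-partition is a partition of $\mathcal H$ into blocks of size at most $k$ such that all hyperplanes in a block share the same normal vector and every point of $\mathcal P$ lies on some hyperplane of each block. $\operatorname{rs}(\mathcal P,\mathcal H)=\max_{S}\,|\{p\in\mathcal P: p\in S\}|\cdot|\{h\in\mathcal H: S\subseteq h\}|$ over affine subspaces $S\subseteq\mathbb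 R^d$. *)

theory Defs
  imports Complex_Main "Jordan_Normal_Form.DL_Rank" "HOL-Library.Disjoint_Sets"
begin

text \<open>Inputs: Alice holds x in X = {0..<a}, Bob holds y in Y = {0..<b}
  (every pair of finite sets is in bijection with such index sets).
  A deterministic protocol is a binary tree; at an Alice node Alice sends one
  bit computed from x, at a Bob node Bob sends one bit computed from y;
  leaves carry the output.\<close>

datatype protocol =
    Leaf bool
  | AliceNode "nat \<Rightarrow> bool" protocol protocol
  | BobNode "nat \<Rightarrow> bool" protocol protocol

fun run :: "protocol \<Rightarrow> nat \<Rightarrow> nat \<Rightarrow> bool" where
  "run (Leaf v) x y = v"
| "run (AliceNode g p0 p1) x y = (if g x then run p1 x y else run p0 x y)"
| "run (BobNode g p0 p1) x y = (if g y then run p1 x y else run p0 x y)"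

fun cost :: "protocol \<Rightarrow> nat \<Rightarrow> nat \<Rightarrow> nat" where
  "cost (Leaf v) x y = 0"
| "cost (AliceNode g p0 p1) x y = Suc (if g x then cost p1 x y else cost p0 x y)"
| "cost (BobNode g p0 p1) x y = Suc (if g y then cost p1 x y else cost p0 x y)"

definition CC_det :: "nat \<Rightarrow> nat \<Rightarrow> (nat \<Rightarrow> nat \<Rightarrow> bool) \<Rightarrow> nat" where
  "CC_det a b f = (LEAST c. \<exists>p. (\<forall>x<a. \<forall>y<b. run p x y = f x y)
                               \<and> (\<forall>x<a. \<forall>y<b. cost p x y \<le> c))"

definition fmat :: "nat \<Rightarrow> nat \<Rightarrow> (nat \<Rightarrow> nat \<Rightarrow> bool) \<Rightarrow> real mat" where
  "fmat a b f = mat a b (\<lambda>(i,j). if f i j then 1 else 0)"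

definition rank01 :: "nat \<Rightarrow> nat \<Rightarrow> (nat \<Rightarrow> nat \<Rightarrow> bool) \<Rightarrow> nat" where
  "rank01 a b f = vec_space.rank a (fmat a b f)"

definition Rd :: "nat \<Rightarrow> (nat \<Rightarrow> real) set" where
  "Rd d = {x. \<forall>i\<ge>d. x i = 0}"

definition ip :: "nat \<Rightarrow> (nat \<Rightarrow> real) \<Rightarrow> (nat \<Rightarrow> real) \<Rightarrow> real" where
  "ip d u v = (\<Sum>i<d. u i * v i)"

definition hplane :: "nat \<Rightarrow> (nat \<Rightarrow> real) \<times> real \<Rightarrow> (nat \<Rightarrow> real) set" where
  "hplane d h = {x \<in> Rd d. ip d (fst h) x = snd h}"

definition affine_subspace :: "nat \<Rightarrow> (nat \<Rightarrow> real) set \<Rightarrow> bool" where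
  "affine_subspace d S \<longleftrightarrow> S \<subseteq> Rd d \<and>
     (\<forall>x\<in>S. \<forall>y\<in>S. \<forall>t::real. (\<lambda>i. (1 - t) * x i + t * y i) \<in> S)"

definition configuration ::
  "nat \<Rightarrow> (nat \<Rightarrow> real) set \<Rightarrow> ((nat \<Rightarrow> real) \<times> real) set \<Rightarrow> bool" where
  "configuration d P H \<longleftrightarrow> finite P \<and> finite H \<and> P \<subseteq> Rd d \<and>
     (\<forall>h\<in>H. fst h \<in> Rd d \<and> fst h \<noteq> (\<lambda>_. 0)) \<and> inj_on (hplane d) H"

definition offsets :: "((nat \<Rightarrow> real) \<times> real) set \<Rightarrow> real set" where
  "offsets H = snd ` H"

definition parallel_partition ::
  "nat \<Rightarrow> nat \<Rightarrow> (nat \<Rightarrow> real) set \<Rightarrow> ((nat \<Rightarrow> real) \<times> real) set \<Rightarrow> bool" where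
  "parallel_partition k d P H \<longleftrightarrow> (\<exists>Bs. partition_on H Bs \<and>
     (\<forall>B\<in>Bs. card B \<le> k \<and> (\<forall>h\<in>B. \<forall>h'\<in>B. fst h = fst h') \<and>
              (\<forall>p\<in>P. \<exists>h\<in>B. p \<in> hplane d h)))"

definition rs :: "nat \<Rightarrow> (nat \<Rightarrow> real) set \<Rightarrow> ((nat \<Rightarrow> real) \<times> real) set \<Rightarrow> nat" where
  "rs d P H = Max {card {p\<in>P. p \<in> S} * card {h\<in>H. S \<subseteq> hplane d h} | S. affine_subspace d S}"

end

theory Submission
  imports Defs
begin

text \<open>
  A rank-\<open>d\<close> factorisation of a Boolean matrix is a set of normals \<open>u\<^sub>i\<close> and points \<open>v\<^sub>j\<close> in \<open>\<real>\<^sup>d\<close> with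
  \<open>u\<^sub>i \<bullet> v\<^sub>j \<in> {0, 1}\<close>, that is, a configuration with a parallel \<open>2\<close>-partition and offsets \<open>0\<close> and \<open>1\<close>.
  Affine subspaces containing many points and contained in many hyperplanes correspond to large
  monochromatic rectangles, up to a factor \<open>2\<close> for the choice of the offset.

  A cheap protocol has few leaves, so one of its leaf rectangles is large. Conversely, suppose that every
  submatrix has a monochromatic rectangle of density \<open>2\<^sup>-\<^sup>c\<close> (Nisan and Wigderson). Such a
  rectangle spans a strip of rows or of columns of about half the rank. Peeling off these strips
  exhausts the matrix in about \<open>r 2\<^sup>c\<close> steps, because a matrix of rank \<open>r\<close> has at most \<open>2\<^sup>r\<close> distinct
  rows and columns. Locating the strip of an input costs \<open>O(c + log r)\<close> bits, and after \<open>log r\<close> rounds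
  the rank is bounded.
\<close>

section \<open>Rank factorisations\<close>

text \<open>Rank is phrased through a factorisation with \<open>k\<close> coordinates, so that
  restricting, transposing and adding a rank-one term need no matrices, and rows and columns may be
  indexed by any sets.\<close>

definition rank_le :: "nat \<Rightarrow> ('a \<Rightarrow> 'b \<Rightarrow> real) \<Rightarrow> 'a set \<Rightarrow> 'b set \<Rightarrow> bool" where
  "rank_le k F I J \<longleftrightarrow> (\<exists>u v. \<forall>i\<in>I. \<forall>j\<in>J. F i j = (\<Sum>l<k. u i l * v l j))"

text \<open>The inner dimension may be indexed by any finite set, such as a coordinate range with a
  gap or a basis; an enumeration of it is padded with zeros up to \<open>k\<close>.\<close>

lemma rank_leI:
  assumes K: "finite K" "card K \<le> k"
    and F: "\<And>i j. i \<in> I \<Longrightarrow> j \<in> J \<Longrightarrow> F i j = (\<Sum>x\<in>K. u i x * v x j)"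
  shows "rank_le k F I J"
proof -
  obtain e where e: "bij_betw e {..<card K} K"
    using ex_bij_betw_nat_finite[OF K(1)] by (auto simp: atLeast0LessThan)
  define u' where "u' = (\<lambda>i l. if l < card K then u i (e l) else 0)"
  define v' where "v' = (\<lambda>l. v (e l))"
  have "F i j = (\<Sum>l<k. u' i l * v' l j)" if "i \<in> I" "j \<in> J" for i j
  proof -
    have "F i j = (\<Sum>l<card K. u i (e l) * v (e l) j)"
      unfolding F[OF that] by (rule sum.reindex_bij_betw[OF e, symmetric])
    also have "\<dots> = (\<Sum>l<card K. u' i l * v' l j)"
      by (simp add: u'_def v'_def)
    also have "\<dots> = (\<Sum>l<k. u' i l * v' l j)"
      using K(2) by (intro sum.mono_neutral_left) (auto simp: u'_def)
    finally show ?thesis .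
  qed
  then show ?thesis
    unfolding rank_le_def by blast
qed

lemma rank_le_mono:
  assumes "rank_le k F I J" "k \<le> k'" "I' \<subseteq> I" "J' \<subseteq> J"
  shows "rank_le k' F I' J'"
proof -
  obtain u v where "\<forall>i\<in>I. \<forall>j\<in>J. F i j = (\<Sum>l<k. u i l * v l j)"
    using assms(1) by (auto simp: rank_le_def)
  then show ?thesis
    using assms(2-) by (intro rank_leI[of "{..<k}" k' I' J' F u v]) auto
qed

lemma rank_le_cong:
  assumes "\<And>i j. i \<in> I \<Longrightarrow> j \<in> J \<Longrightarrow> F i j = G i j"
  shows "rank_le k F I J \<longleftrightarrow> rank_le k G I J"
  unfolding rank_le_def using assms by simp

lemma rank_le_add_outer:
  assumes "rank_le k F I J"
  shows "rank_le (Suc k) (\<lambda>i j. F i j + g i * h j) I J"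
proof -
  obtain u v where uv: "\<forall>i\<in>I. \<forall>j\<in>J. F i j = (\<Sum>l<k. u i l * v l j)"
    using assms by (auto simp: rank_le_def)
  let ?u = "\<lambda>i l. if l < k then u i l else g i"
  let ?v = "\<lambda>l j. if l < k then v l j else h j"
  show ?thesis unfolding rank_le_def
    by (rule exI[of _ ?u], rule exI[of _ ?v]) (use uv in auto)
qed

lemma rank_le_transpose:
  assumes "rank_le k F I J"
  shows "rank_le k (\<lambda>j i. F i j) J I"
proof -
  obtain u v where uv: "\<forall>i\<in>I. \<forall>j\<in>J. F i j = (\<Sum>l<k. u i l * v l j)"
    using assms by (auto simp: rank_le_def)
  show ?thesis unfolding rank_le_def
    by (rule exI[of _ "\<lambda>j l. v l j"], rule exI[of _ "\<lambda>l i. u i l"]) (use uv in \<open>auto simp: mult.commute\<close>)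
qed

lemma rank_le_0: "rank_le 0 F I J \<longleftrightarrow> (\<forall>i\<in>I. \<forall>j\<in>J. F i j = 0)"
  by (simp add: rank_le_def)

text \<open>One step of Gaussian elimination. Since the entry at \<open>i0\<close>,
  \<open>j0\<close> is nonzero, the vector of column \<open>j0\<close> has a nonzero coordinate
  \<open>l0\<close>; subtracting from each column the multiple of column \<open>j0\<close> that
  cancels coordinate \<open>l0\<close> leaves only \<open>k\<close> coordinates.\<close>

lemma rank_le_eliminate_column:
  assumes F: "rank_le (Suc k) F I J" and ij: "i0 \<in> I" "j0 \<in> J" "F i0 j0 \<noteq> 0"
  obtains c where "rank_le k (\<lambda>i j. F i j - c j * F i j0) I J"
proof -
  obtain u v where uv: "\<And>i j. i \<in> I \<Longrightarrow> j \<in> J \<Longrightarrow> F i j = (\<Sum>l<Suc k. u i l * v l j)"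
    using F by (auto simp: rank_le_def)
  obtain l0 where l0: "l0 < Suc k" "v l0 j0 \<noteq> 0"
  proof -
    have "\<exists>l\<in>{..<Suc k}. u i0 l * v l j0 \<noteq> 0"
      using ij(3) unfolding uv[OF ij(1,2)] by (meson sum.neutral)
    then show ?thesis using that by auto
  qed
  define c where "c = (\<lambda>j. v l0 j / v l0 j0)"
  have "rank_le k (\<lambda>i j. F i j - c j * F i j0) I J"
  proof (rule rank_leI[of "{..<Suc k} - {l0}" k I J _ u "\<lambda>l j. v l j - c j * v l j0"])
    fix i j assume i: "i \<in> I" and j: "j \<in> J"
    have "F i j - c j * F i j0 = (\<Sum>l<Suc k. u i l * (v l j - c j * v l j0))"
      unfolding uv[OF i j] uv[OF i ij(2)] sum_distrib_left sum_subtractf[symmetric]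
      by (rule sum.cong) (auto simp: algebra_simps)
    also have "\<dots> = (\<Sum>l\<in>{..<Suc k} - {l0}. u i l * (v l j - c j * v l j0))"
      using l0 by (intro sum.mono_neutral_right) (auto simp: c_def)
    finally show "F i j - c j * F i j0 = (\<Sum>l\<in>{..<Suc k} - {l0}. u i l * (v l j - c j * v l j0))" .
  qed (use l0 in auto)
  then show ?thesis by (rule that)
qed

text \<open>Eliminating with a column of \<open>J1\<close> leaves the rows \<open>I1\<close> unchanged, because that column vanishes on them.\<close>

lemma rank_le_zero_block:
  assumes "rank_le k F I J" "I1 \<subseteq> I" "J1 \<subseteq> J" "\<And>i j. i \<in> I1 \<Longrightarrow> j \<in> J1 \<Longrightarrow> F i j = 0"
  shows "\<exists>k1 k2. k1 + k2 \<le> k \<and> rank_le k1 F I1 J \<and> rank_le k2 F I J1"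
  using assms
proof (induction k arbitrary: F)
  case 0
  then show ?case by (auto simp: rank_le_0)
next
  case (Suc k)
  show ?case
  proof (cases "\<forall>i\<in>I. \<forall>j\<in>J1. F i j = 0")
    case True
    then have "rank_le 0 F I J1" by (simp add: rank_le_0)
    moreover have "rank_le (Suc k) F I1 J"
      using Suc.prems rank_le_mono by blast
    ultimately show ?thesis by (metis add_0_right order_refl)
  next
    case False
    then obtain i0 j0 where ij: "i0 \<in> I" "j0 \<in> J1" "F i0 j0 \<noteq> 0" by blast
    obtain c where c: "rank_le k (\<lambda>i j. F i j - c j * F i j0) I J" (is "rank_le k ?F I J")
      using rank_le_eliminate_column[OF Suc.prems(1) ij(1) _ ij(3)] ij(2) Suc.prems(3) by blast
    have "?F i j = 0" if "i \<in> I1" "j \<in> J1" for i j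
      using Suc.prems(4) that ij(2) by simp
    from Suc.IH[OF c Suc.prems(2,3) this] obtain k1 k2
      where k: "k1 + k2 \<le> k" "rank_le k1 ?F I1 J" "rank_le k2 ?F I J1" by blast
    have "rank_le k1 F I1 J"
      using k(2) Suc.prems(4)[OF _ ij(2)] by (subst rank_le_cong[of _ _ F ?F]) auto
    \<comment> \<open>The rank-one term is restored at a cost only on \<open>I\<close> times
      \<open>J1\<close>, so \<open>k1 + k2\<close> grows by one, just as \<open>k\<close>
      does.\<close>
    moreover have "rank_le (Suc k2) F I J1"
      using rank_le_add_outer[OF k(3), of "\<lambda>i. F i j0" c]
      by (simp add: algebra_simps)
    ultimately show ?thesis
      using k(1) by (intro exI[of _ k1] exI[of _ "Suc k2"]) auto
  qed
qed

text \<open>The pivot columns of the elimination determine each row. Rows that agree in a pivot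
  column have the same multiples of it subtracted, so their agreement elsewhere can be tested before
  or after the elimination.\<close>

lemma rank_le_determining_columns:
  assumes "rank_le k F I J"
  shows "\<exists>J0\<subseteq>J. finite J0 \<and> card J0 \<le> k \<and>
    (\<forall>i\<in>I. \<forall>i'\<in>I. (\<forall>j\<in>J0. F i j = F i' j) \<longrightarrow> (\<forall>j\<in>J. F i j = F i' j))"
  using assms
proof (induction k arbitrary: F)
  case 0
  then show ?case by (intro exI[of _ "{}"]) (auto simp: rank_le_0)
next
  case (Suc k)
  show ?case
  proof (cases "\<forall>i\<in>I. \<forall>j\<in>J. F i j = 0")
    case True
    then show ?thesis by (intro exI[of _ "{}"]) auto
  next
    case False
    then obtain i0 j0 where ij: "i0 \<in> I" "j0 \<in> J" "F i0 j0 \<noteq> 0" by blast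
    then obtain c where c: "rank_le k (\<lambda>i j. F i j - c j * F i j0) I J" (is "rank_le k ?F I J")
      using rank_le_eliminate_column[OF Suc.prems] by blast
    from Suc.IH[OF this] obtain J0 where J0: "J0 \<subseteq> J" "finite J0" "card J0 \<le> k"
      and det: "\<And>i i' j. i \<in> I \<Longrightarrow> i' \<in> I \<Longrightarrow> (\<forall>j\<in>J0. ?F i j = ?F i' j) \<Longrightarrow> j \<in> J \<Longrightarrow> ?F i j = ?F i' j"
      by blast
    have "F i j = F i' j" if i: "i \<in> I" "i' \<in> I" and eq: "\<forall>j\<in>insert j0 J0. F i j = F i' j" and j: "j \<in> J" for i i' j
      using det[OF i _ j] eq by simp
    moreover have "insert j0 J0 \<subseteq> J" "finite (insert j0 J0)" "card (insert j0 J0) \<le> Suc k"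
      using J0 ij(2) by (simp_all add: card_insert_if)
    ultimately show ?thesis by meson
  qed
qed

section \<open>Agreement of factorisations with the rank of a matrix\<close>

lemma rank_le_rank01:
  "rank_le (rank01 a b f) (\<lambda>i j. of_bool (f i j)) {..<a} {..<b}"
proof -
  interpret vec_space "TYPE(real)" a .
  let ?A = "fmat a b f"
  have A: "?A \<in> carrier_mat a b" by (simp add: fmat_def)
  have cols: "set (cols ?A) \<subseteq> carrier_vec a" using cols_dim[of ?A] A by simp
  have "lin_indpt {}"
    by (metis empty_subsetI fin_dim finite_basis_exists subset_li_is_li basis_def)
  \<comment> \<open>A maximal independent set of columns has \<open>rank01\<close> elements and
    spans all columns. The entries of its vectors and the coefficients of the columns will be the
    two factors.\<close>
  then obtain U where U: "finite U" "maximal U (\<lambda>T. T \<subseteq> set (cols ?A) \<and> lin_indpt T)"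
    using maximal_exists_superset[of "set (cols ?A)" "\<lambda>T. T \<subseteq> set (cols ?A) \<and> lin_indpt T" "{}"] by auto
  have card: "rank01 a b f = card U"
    unfolding rank01_def by (rule rank_card_indpt[OF A U(2)])
  have Usub: "U \<subseteq> set (cols ?A)" "lin_indpt U" using U(2) by (auto simp: maximal_def)
  have Uc: "U \<subseteq> carrier_vec a" using Usub cols by blast
  have in_span: "s \<in> span U" if s: "s \<in> set (cols ?A)" for s
  proof (rule ccontr)
    assume ns: "s \<notin> span U"
    have "lin_indpt (U \<union> {s})"
      using lin_dep_iff_in_span[OF Uc Usub(2)] s ns cols Uc span_mem by blast
    moreover have "s \<notin> U" using ns Uc span_mem by blast
    ultimately show False
      using U(2) s Usub unfolding maximal_def by blast
  qed
  have "\<exists>c. \<forall>i<a. of_bool (f i j) = (\<Sum>w\<in>U. c w * w $ i)" if j: "j < b" for j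
  proof -
    have "col ?A j \<in> span U"
      using in_span j A by (metis carrier_matD(2) cols_length cols_nth nth_mem)
    then obtain c where c: "col ?A j = lincomb c U"
      using finite_in_span[OF U(1)] Uc by (metis module_vec_simps(3))
    then have "of_bool (f i j) = (\<Sum>w\<in>U. c w * w $ i)" if "i < a" for i
      unfolding lincomb_index[OF that Uc, symmetric] c[symmetric]
      using that j by (simp add: fmat_def)
    then show ?thesis by blast
  qed
  then obtain c where c: "\<And>i j. j < b \<Longrightarrow> i < a \<Longrightarrow> of_bool (f i j) = (\<Sum>w\<in>U. c j w * w $ i)"
    by metis
  show ?thesis
    by (rule rank_leI[of U _ _ _ _ "\<lambda>i w. w $ i" "\<lambda>w j. c j w"])
      (use U c card in \<open>auto simp: mult.commute\<close>)
qed

text \<open>Each summand is an outer product, of rank at most 1, and rank is subadditive.\<close>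

lemma rank_mat_sum_outer_le:
  fixes u :: "nat \<Rightarrow> nat \<Rightarrow> real"
  shows "vec_space.rank a (mat a b (\<lambda>(i,j). \<Sum>l<k. u i l * v l j)) \<le> k"
proof (induction k)
  interpret vec_space "TYPE(real)" a .
  case 0
  have "mat a b (\<lambda>(i,j). \<Sum>l<0::nat. u i l * v l j) = 0\<^sub>m a b" by (rule eq_matI) auto
  then show ?case using rank_0I[of b] by (simp only:)
next
  interpret vec_space "TYPE(real)" a .
  case (Suc k)
  let ?B = "mat a b (\<lambda>(i,j). u i k * v k j)"
  let ?A = "mat a b (\<lambda>(i,j). \<Sum>l<k. u i l * v l j)"
  have "mat a b (\<lambda>(i,j). \<Sum>l<Suc k. u i l * v l j) = ?A + ?B" by auto
  moreover have "rank (?A + ?B) \<le> rank ?A + rank ?B" by (rule rank_subadditive) auto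
  moreover have "rank ?B \<le> 1"
    by (rule rank_le_1_product_entries[of _ b "\<lambda>i. u i k" "\<lambda>j. v k j"]) auto
  ultimately show ?case using Suc by simp
qed

lemma rank01_le:
  assumes "rank_le k (\<lambda>i j. of_bool (f i j)) {..<a} {..<b}"
  shows "rank01 a b f \<le> k"
proof -
  obtain u v :: "nat \<Rightarrow> nat \<Rightarrow> real"
    where uv: "\<forall>i\<in>{..<a}. \<forall>j\<in>{..<b}. of_bool (f i j) = (\<Sum>l<k. u i l * v l j)"
    using assms unfolding rank_le_def by blast
  have "fmat a b f = mat a b (\<lambda>(i,j). of_bool (f i j))"
    by (auto simp: fmat_def)
  also have "\<dots> = mat a b (\<lambda>(i,j). \<Sum>l<k. u i l * v l j)"
    using uv by (intro eq_matI) auto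
  finally show ?thesis
    unfolding rank01_def by (simp add: rank_mat_sum_outer_le)
qed

section \<open>Protocols and monochromatic rectangles\<close>

text \<open>Correctness and cost are relative to a rectangle of inputs, because protocols are built
  by recursion on subrectangles.\<close>

definition protocol_le :: "nat \<Rightarrow> (nat \<Rightarrow> nat \<Rightarrow> bool) \<Rightarrow> nat set \<Rightarrow> nat set \<Rightarrow> bool" where
  "protocol_le c f I J \<longleftrightarrow> (\<exists>p. \<forall>x\<in>I. \<forall>y\<in>J. run p x y = f x y \<and> cost p x y \<le> c)"

text \<open>The density bound, 2 to the power \<open>-c\<close>, is cross-multiplied, so that it
  stays in the natural numbers and makes sense for empty \<open>I\<close> or
  \<open>J\<close>.\<close>

definition large_mono_rect :: "nat \<Rightarrow> ('a \<Rightarrow> 'b \<Rightarrow> bool) \<Rightarrow> 'a set \<Rightarrow> 'b set \<Rightarrow> bool" where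
  "large_mono_rect c f I J \<longleftrightarrow> (\<exists>I1\<subseteq>I. \<exists>J1\<subseteq>J. (\<exists>v. \<forall>i\<in>I1. \<forall>j\<in>J1. f i j = v) \<and>
     card I * card J \<le> card I1 * card J1 * 2 ^ c)"

lemma protocol_le_mono:
  assumes "protocol_le c f I J" "c \<le> c'" "I' \<subseteq> I" "J' \<subseteq> J"
  shows "protocol_le c' f I' J'"
  using assms unfolding protocol_le_def by (meson order_trans subsetD)

lemma protocol_le_const:
  assumes "\<And>x y. x \<in> I \<Longrightarrow> y \<in> J \<Longrightarrow> f x y = v"
  shows "protocol_le c f I J"
  unfolding protocol_le_def using assms by (intro exI[of _ "Leaf v"]) auto

lemma protocol_le_empty: "protocol_le c f {} J"
  by (rule protocol_le_const) simp

lemma protocol_le_comp: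
  assumes "protocol_le c f I J" "\<And>x. x \<in> I' \<Longrightarrow> p x \<in> I" "\<And>y. y \<in> J' \<Longrightarrow> q y \<in> J"
  shows "protocol_le c (\<lambda>x y. f (p x) (q y)) I' J'"
proof -
  \<comment> \<open>In each case the two ignored arguments are the original subtrees;
    \<open>P\<close> and \<open>Q\<close> are their relabelled versions.\<close>
  define relabel where "relabel = rec_protocol Leaf
    (\<lambda>g _ _ P Q. AliceNode (\<lambda>x. g (p x)) P Q) (\<lambda>g _ _ P Q. BobNode (\<lambda>y. g (q y)) P Q)"
  have "run (relabel P) x y = run P (p x) (q y)" "cost (relabel P) x y = cost P (p x) (q y)" for P x y
    by (induction P) (auto simp: relabel_def)
  then show ?thesis
    using assms unfolding protocol_le_def by metis
qed

lemma protocol_le_transpose: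
  assumes "protocol_le c f I J"
  shows "protocol_le c (\<lambda>y x. f x y) J I"
proof -
  define flip where "flip = rec_protocol Leaf
    (\<lambda>g _ _ P Q. BobNode g P Q) (\<lambda>g _ _ P Q. AliceNode g P Q)"
  have "run (flip P) y x = run P x y" "cost (flip P) y x = cost P x y" for P x y
    by (induction P) (auto simp: flip_def)
  then show ?thesis
    using assms unfolding protocol_le_def by metis
qed

lemma protocol_le_alice_bit:
  assumes "protocol_le c f {x\<in>I. g x} J" "protocol_le c f {x\<in>I. \<not> g x} J"
  shows "protocol_le (Suc c) f I J"
proof -
  obtain p q where "\<forall>x\<in>{x\<in>I. g x}. \<forall>y\<in>J. run p x y = f x y \<and> cost p x y \<le> c"
    "\<forall>x\<in>{x\<in>I. \<not> g x}. \<forall>y\<in>J. run q x y = f x y \<and> cost q x y \<le> c"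
    using assms by (auto simp: protocol_le_def)
  then show ?thesis
    unfolding protocol_le_def by (intro exI[of _ "AliceNode g q p"]) auto
qed

text \<open>Alice sends the \<open>q\<close> binary digits of \<open>h x\<close>, the most
  significant first; afterwards both players know which rows remain.\<close>

lemma protocol_le_alice_number:
  fixes h :: "nat \<Rightarrow> nat"
  assumes "\<And>n. protocol_le c f {x\<in>I. h x = n} J" "\<And>x. x \<in> I \<Longrightarrow> h x < 2 ^ q"
  shows "protocol_le (c + q) f I J"
  using assms
proof (induction q arbitrary: I h)
  case 0
  then have "{x\<in>I. h x = 0} = I" by auto
  then show ?case using 0(1)[of 0] by simp
next
  case (Suc q)
  have "protocol_le (c + q) f {x\<in>I. h x \<ge> 2 ^ q} J"
  proof (rule Suc.IH[where h = "\<lambda>x. h x - 2 ^ q"])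
    show "protocol_le c f {x \<in> {x \<in> I. 2 ^ q \<le> h x}. h x - 2 ^ q = n} J" for n
      by (rule protocol_le_mono[OF Suc.prems(1)[of "n + 2 ^ q"]]) auto
    show "h x - 2 ^ q < 2 ^ q" if "x \<in> {x \<in> I. 2 ^ q \<le> h x}" for x
      using Suc.prems(2)[of x] that by auto
  qed
  moreover have "protocol_le (c + q) f {x\<in>I. \<not> h x \<ge> 2 ^ q} J"
  proof (rule Suc.IH[where h = h])
    show "protocol_le c f {x \<in> {x \<in> I. \<not> 2 ^ q \<le> h x}. h x = n} J" for n
      by (rule protocol_le_mono[OF Suc.prems(1)[of n]]) auto
  qed auto
  ultimately show ?case
    using protocol_le_alice_bit[of "c + q" f I "\<lambda>x. h x \<ge> 2 ^ q" J] by simp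
qed

lemma protocol_le_bob_number:
  fixes h :: "nat \<Rightarrow> nat"
  assumes "\<And>n. protocol_le c f I {y\<in>J. h y = n}" "\<And>y. y \<in> J \<Longrightarrow> h y < 2 ^ q"
  shows "protocol_le (c + q) f I J"
proof -
  have "protocol_le (c + q) (\<lambda>y x. f x y) J I"
    by (rule protocol_le_alice_number[where h = h]) (use assms protocol_le_transpose in auto)
  then show ?thesis by (drule_tac protocol_le_transpose) simp
qed

text \<open>Alice sends her entries in the columns \<open>J0\<close>, one bit each. All rows still
  possible then coincide on \<open>J\<close>.\<close>

lemma protocol_le_determining_columns:
  assumes "finite J0"
    "\<And>i i' j. i \<in> I \<Longrightarrow> i' \<in> I \<Longrightarrow> j \<in> J \<Longrightarrow> (\<forall>j\<in>J0. f i j = f i' j) \<Longrightarrow> f i j = f i' j"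
  shows "protocol_le (Suc (card J0)) f I J"
  using assms
proof (induction J0 arbitrary: I rule: finite_induct)
  case empty
  show ?case
  proof (cases "I = {}")
    case False
    then obtain i0 where "i0 \<in> I" by blast
    then have "f i j = f i0 j" if "i \<in> I" "j \<in> J" for i j
      using empty that by blast
    \<comment> \<open>Bob can read the answer off the row of \<open>i0\<close>; his single bit is
      the extra one in \<open>Suc\<close>.\<close>
    then show ?thesis unfolding protocol_le_def
      by (intro exI[of _ "BobNode (f i0) (Leaf False) (Leaf True)"]) auto
  qed (simp add: protocol_le_empty)
next
  case (insert j0 J0)
  have "protocol_le (Suc (card J0)) f {i\<in>I. f i j0} J"
    by (rule insert.IH) (use insert.prems in auto)
  moreover have "protocol_le (Suc (card J0)) f {i\<in>I. \<not> f i j0} J"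
    by (rule insert.IH) (use insert.prems in auto)
  ultimately show ?case
    using protocol_le_alice_bit insert.hyps by simp
qed

text \<open>Linear in the rank, hence useful for bounded rank only, where the halving recursion
  stops.\<close>

lemma protocol_le_rank_le:
  assumes "rank_le k (\<lambda>i j. of_bool (f i j)) I J"
  shows "protocol_le (Suc k) f I J"
proof -
  obtain J0 where "J0 \<subseteq> J" "finite J0" "card J0 \<le> k"
    and "\<forall>i\<in>I. \<forall>i'\<in>I. (\<forall>j\<in>J0. f i j = f i' j) \<longrightarrow> (\<forall>j\<in>J. f i j = f i' j)"
    using rank_le_determining_columns[OF assms] by (auto simp: of_bool_eq_iff)
  then have "protocol_le (Suc (card J0)) f I J"
    by (intro protocol_le_determining_columns) blast+
  then show ?thesis
    by (rule protocol_le_mono) (use \<open>card J0 \<le> k\<close> in auto)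
qed

lemma protocol_le_CC_det: "protocol_le (CC_det a b f) f {..<a} {..<b}"
proof -
  \<comment> \<open>The protocol in which Alice sends her whole row shows that the minimum in
    \<open>CC_det\<close> is over a nonempty set.\<close>
  have "protocol_le (Suc (card {..<b})) f {..<a} {..<b}"
    by (rule protocol_le_determining_columns) auto
  then have "\<exists>c p. (\<forall>x<a. \<forall>y<b. run p x y = f x y) \<and> (\<forall>x<a. \<forall>y<b. cost p x y \<le> c)"
    unfolding protocol_le_def by (metis lessThan_iff)
  from LeastI_ex[OF this] show ?thesis
    unfolding CC_det_def[symmetric] protocol_le_def by (metis lessThan_iff)
qed

lemma CC_det_le:
  assumes "protocol_le c f {..<a} {..<b}"
  shows "CC_det a b f \<le> c"
  unfolding CC_det_def
  by (rule Least_le) (use assms in \<open>auto simp: protocol_le_def\<close>)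

section \<open>Large monochromatic rectangles from protocols\<close>

lemma large_mono_rect_transpose:
  assumes "large_mono_rect c f I J"
  shows "large_mono_rect c (\<lambda>y x. f x y) J I"
proof -
  obtain I1 J1 v where "I1 \<subseteq> I" "J1 \<subseteq> J" "\<forall>i\<in>I1. \<forall>j\<in>J1. f i j = v"
    "card I * card J \<le> card I1 * card J1 * 2 ^ c"
    using assms unfolding large_mono_rect_def by blast
  then show ?thesis
    unfolding large_mono_rect_def
    by (intro exI[of _ J1] exI[of _ I1] conjI exI[of _ v]) (auto simp: mult.commute)
qed

lemma large_mono_rect_empty: "I = {} \<or> J = {} \<Longrightarrow> large_mono_rect c f I J"
  unfolding large_mono_rect_def by (intro exI[of _ I] exI[of _ J]) auto

text \<open>One of the two parts has at least half of the rows, so its rectangle loses at most a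
  factor of 2 in density.\<close>

lemma large_mono_rect_split:
  assumes "finite I" "large_mono_rect c f {x\<in>I. g x} J" "large_mono_rect c f {x\<in>I. \<not> g x} J"
  shows "large_mono_rect (Suc c) f I J"
proof -
  have "card I = card ({x\<in>I. g x} \<union> {x\<in>I. \<not> g x})" by (rule arg_cong[of _ _ card]) auto
  also have "\<dots> = card {x\<in>I. g x} + card {x\<in>I. \<not> g x}"
    using assms(1) by (intro card_Un_disjoint) auto
  finally have "card I \<le> 2 * card {x\<in>I. g x} \<or> card I \<le> 2 * card {x\<in>I. \<not> g x}" by linarith
  moreover have "{x\<in>I. g x} \<subseteq> I" "{x\<in>I. \<not> g x} \<subseteq> I" by auto
  ultimately obtain I' where I': "I' \<subseteq> I" "card I \<le> 2 * card I'" "large_mono_rect c f I' J"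
    using assms(2,3) by metis
  then obtain I1 J1 v where R: "I1 \<subseteq> I'" "J1 \<subseteq> J" "\<forall>i\<in>I1. \<forall>j\<in>J1. f i j = v"
    "card I' * card J \<le> card I1 * card J1 * 2 ^ c"
    unfolding large_mono_rect_def by blast
  have "card I * card J \<le> 2 * (card I' * card J)" using mult_le_mono1[OF I'(2)] by (simp add: mult.assoc)
  also have "\<dots> \<le> card I1 * card J1 * 2 ^ Suc c" using R(4) by simp
  finally show ?thesis
    unfolding large_mono_rect_def using R(1-3) I'(1)
    by (intro exI[of _ I1] exI[of _ J1] conjI exI[of _ v]) auto
qed

text \<open>Each bit splits the inputs of its sender in two and so costs at most a factor of 2 in
  density; a leaf is monochromatic.\<close>

lemma protocol_large_mono_rect:
  assumes "finite I" "finite J" "\<forall>x\<in>I. \<forall>y\<in>J. run p x y = f x y \<and> cost p x y \<le> c"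
  shows "large_mono_rect c f I J"
  using assms
proof (induction p arbitrary: I J c)
  case (Leaf v)
  have "card I * card J \<le> card I * card J * 2 ^ c" by simp
  moreover have "\<forall>i\<in>I. \<forall>j\<in>J. f i j = v" using Leaf by auto
  ultimately show ?case unfolding large_mono_rect_def by blast
next
  case (AliceNode g p0 p1)
  show ?case
  proof (cases "I = {} \<or> J = {}")
    case False
    then obtain x y where "x \<in> I" "y \<in> J" by blast
    then have "Suc 0 \<le> cost (AliceNode g p0 p1) x y" "cost (AliceNode g p0 p1) x y \<le> c"
      using AliceNode.prems(3) by (simp, blast)
    then obtain c' where c: "c = Suc c'" by (cases c) auto
    have run: "run (AliceNode g p0 p1) x y = f x y \<and> cost (AliceNode g p0 p1) x y \<le> Suc c'"
      if "x \<in> I" "y \<in> J" for x y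
      using AliceNode.prems(3) that c by blast
    have "run p1 x y = f x y \<and> cost p1 x y \<le> c'" if "x \<in> I" "y \<in> J" "g x" for x y
      using run[OF that(1,2)] that(3) by simp
    then have "large_mono_rect c' f {x\<in>I. g x} J"
      using AliceNode.prems(1,2) by (intro AliceNode.IH(2)) auto
    moreover have "run p0 x y = f x y \<and> cost p0 x y \<le> c'" if "x \<in> I" "y \<in> J" "\<not> g x" for x y
      using run[OF that(1,2)] that(3) by simp
    then have "large_mono_rect c' f {x\<in>I. \<not> g x} J"
      using AliceNode.prems(1,2) by (intro AliceNode.IH(1)) auto
    ultimately show ?thesis unfolding c by (rule large_mono_rect_split[OF AliceNode.prems(1)])
  qed (rule large_mono_rect_empty)
next
  case (BobNode g p0 p1)
  show ?case
  proof (cases "I = {} \<or> J = {}")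
    case False
    then obtain x y where "x \<in> I" "y \<in> J" by blast
    then have "Suc 0 \<le> cost (BobNode g p0 p1) x y" "cost (BobNode g p0 p1) x y \<le> c"
      using BobNode.prems(3) by (simp, blast)
    then obtain c' where c: "c = Suc c'" by (cases c) auto
    have run: "run (BobNode g p0 p1) x y = f x y \<and> cost (BobNode g p0 p1) x y \<le> Suc c'"
      if "x \<in> I" "y \<in> J" for x y
      using BobNode.prems(3) that c by blast
    have "run p1 x y = f x y \<and> cost p1 x y \<le> c'" if "x \<in> I" "y \<in> J" "g y" for x y
      using run[OF that(1,2)] that(3) by simp
    then have "large_mono_rect c' f I {y\<in>J. g y}"
      using BobNode.prems(1,2) by (intro BobNode.IH(2)) auto
    moreover have "run p0 x y = f x y \<and> cost p0 x y \<le> c'" if "x \<in> I" "y \<in> J" "\<not> g y" for x y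
      using run[OF that(1,2)] that(3) by simp
    then have "large_mono_rect c' f I {y\<in>J. \<not> g y}"
      using BobNode.prems(1,2) by (intro BobNode.IH(1)) auto
    ultimately have "large_mono_rect (Suc c') (\<lambda>y x. f x y) J I"
      using large_mono_rect_split[OF BobNode.prems(2), of c' "\<lambda>y x. f x y" g I]
        large_mono_rect_transpose by blast
    then show ?thesis unfolding c by (drule_tac large_mono_rect_transpose) simp
  qed (rule large_mono_rect_empty)
qed

text \<open>Alice and Bob each announce the label of their input, namely the first step of the peeling process
  at which it is removed (or a bound for it), at a cost of about \<open>log t\<close> bits. They are then left with a
  rectangle of smaller rank, which replaces the balancing of a deep protocol tree.\<close>

definition low_rank_labels :: "nat \<Rightarrow> nat \<Rightarrow> ('a \<Rightarrow> 'b \<Rightarrow> real) \<Rightarrow> 'a set \<Rightarrow> 'b set \<Rightarrow> bool" where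
  "low_rank_labels t k F I J \<longleftrightarrow> (\<exists>\<alpha> \<beta>. (\<forall>x. \<alpha> x \<le> t) \<and> (\<forall>y. \<beta> y \<le> t) \<and>
    (\<forall>m n. rank_le k F {x\<in>I. \<alpha> x = m} {y\<in>J. \<beta> y = n}))"

lemma low_rank_labels_transpose:
  assumes "low_rank_labels t k F I J"
  shows "low_rank_labels t k (\<lambda>y x. F x y) J I"
  using assms rank_le_transpose unfolding low_rank_labels_def by blast

lemma low_rank_labels_empty: "I = {} \<or> J = {} \<Longrightarrow> low_rank_labels t k F I J"
  unfolding low_rank_labels_def by (intro exI[of _ "\<lambda>_. 0"]) (auto simp: rank_le_def)

text \<open>The new strip gets label 0 and the other row labels move up by one. The column labels
  can stay, since the strip has low rank against all of \<open>J\<close>.\<close>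

lemma low_rank_labels_extend:
  assumes "rank_le k F I1 J" "low_rank_labels t k F (I - I1) J"
  shows "low_rank_labels (Suc t) k F I J"
proof -
  obtain \<alpha> \<beta> where ab: "\<And>x. \<alpha> x \<le> t" "\<And>y. \<beta> y \<le> t"
    "\<And>m n. rank_le k F {x\<in>I - I1. \<alpha> x = m} {y\<in>J. \<beta> y = n}"
    using assms(2) unfolding low_rank_labels_def by blast
  let ?\<alpha> = "\<lambda>x. if x \<in> I1 then 0 else Suc (\<alpha> x)"
  have "rank_le k F {x\<in>I. ?\<alpha> x = m} {y\<in>J. \<beta> y = n}" for m n
  proof (cases m)
    case 0
    show ?thesis by (rule rank_le_mono[OF assms(1)]) (use 0 in \<open>auto split: if_splits\<close>)
  next
    case (Suc m')
    show ?thesis by (rule rank_le_mono[OF ab(3)[of m' n]]) (use Suc in \<open>auto split: if_splits\<close>)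
  qed
  moreover have "?\<alpha> x \<le> Suc t" "\<beta> y \<le> Suc t" for x y
    using ab(1)[of x] ab(2)[of y] by auto
  ultimately show ?thesis
    unfolding low_rank_labels_def by (intro exI[of _ ?\<alpha>] exI[of _ \<beta>] conjI allI)
qed

text \<open>The rectangle uses at most all columns, so its share of the rows is at least its
  density.\<close>

lemma large_mono_rect_shrinks_rows:
  assumes "finite I" "finite J" "J \<noteq> {}" "I1 \<subseteq> I" "J1 \<subseteq> J"
    and "card I * card J \<le> card I1 * card J1 * 2 ^ c"
  shows "real (card (I - I1)) \<le> real (card I) * (1 - 1 / 2 ^ c)"
proof -
  have "card J > 0" "card J1 \<le> card J" "card I1 \<le> card I"
    using assms(1-5) by (auto intro: card_mono simp: card_gt_0_iff)
  have "card I * card J \<le> card I1 * 2 ^ c * card J1" using assms(6) by (simp add: mult_ac)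
  also have "\<dots> \<le> card I1 * 2 ^ c * card J" using \<open>card J1 \<le> card J\<close> by (rule mult_le_mono2)
  finally have "card I \<le> card I1 * 2 ^ c" using \<open>card J > 0\<close> by simp
  then have "real (card I) \<le> real (card I1 * 2 ^ c)" by (rule of_nat_mono)
  then have "real (card I) / 2 ^ c \<le> real (card I1)" by (simp add: field_simps)
  moreover have "real (card (I - I1)) = real (card I) - real (card I1)"
    using assms \<open>card I1 \<le> card I\<close> by (simp add: card_Diff_subset finite_subset of_nat_diff)
  ultimately show ?thesis by (simp add: algebra_simps)
qed

text \<open>After subtracting the constant value of the monochromatic rectangle \<open>I1 \<times> J1\<close>, the rank is at most
  \<open>k + 1\<close>, so one of the strips \<open>I1 \<times> J\<close> and \<open>I \<times> J1\<close> has rank at most \<open>(k + 1) div 2\<close>; adding the constant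
  back costs \<open>1\<close> more. That strip is peeled off.\<close>

lemma low_rank_labels_halving:
  assumes "finite I" "finite J" "rank_le k (\<lambda>i j. of_bool (f i j)) I J"
    and "\<And>I' J'. I' \<subseteq> I \<Longrightarrow> J' \<subseteq> J \<Longrightarrow> large_mono_rect c f I' J'"
    and "real (card I) * real (card J) * (1 - 1 / 2 ^ c) ^ t < 1"
  shows "low_rank_labels t ((k + 3) div 2) (\<lambda>i j. of_bool (f i j)) I J"
  using assms
proof (induction t arbitrary: I J)
  case 0
  \<comment> \<open>The number of entries is an integer, so below 1 it vanishes and nothing is left
    to peel.\<close>
  then have "real (card I * card J) < 1" by simp
  then have "card I * card J = 0" by linarith
  then show ?case using 0 by (intro low_rank_labels_empty) auto
next
  case (Suc t)
  let ?f = "\<lambda>i j. of_bool (f i j) :: real"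
  show ?case
  proof (cases "I = {} \<or> J = {}")
    case False
    have "large_mono_rect c f I J" by (rule Suc.prems(4)) auto
    then obtain I1 J1 v where R: "I1 \<subseteq> I" "J1 \<subseteq> J" "\<forall>i\<in>I1. \<forall>j\<in>J1. f i j = v"
      and size: "card I * card J \<le> card I1 * card J1 * 2 ^ c"
      unfolding large_mono_rect_def by blast
    \<comment> \<open>Which strip has low rank is not known yet, so the decrease of the number of
      entries is prepared for removing rows and for removing columns.\<close>
    have "real (card (I - I1)) \<le> real (card I) * (1 - 1 / 2 ^ c)"
      using False size by (intro large_mono_rect_shrinks_rows[OF Suc.prems(1,2) _ R(1,2)]) auto
    then have "real (card (I - I1)) * real (card J) * (1 - 1 / 2 ^ c) ^ t
        \<le> (real (card I) * (1 - 1 / 2 ^ c)) * real (card J) * (1 - 1 / 2 ^ c) ^ t"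
      by (intro mult_right_mono) auto
    also have "\<dots> < 1" using Suc.prems(5) by (simp add: mult_ac)
    finally have small_I: "real (card (I - I1)) * real (card J) * (1 - 1 / 2 ^ c) ^ t < 1" .
    have "real (card (J - J1)) \<le> real (card J) * (1 - 1 / 2 ^ c)"
      using False size by (intro large_mono_rect_shrinks_rows[OF Suc.prems(2,1) _ R(2,1)]) (auto simp: mult_ac)
    then have "real (card I) * real (card (J - J1)) * (1 - 1 / 2 ^ c) ^ t
        \<le> real (card I) * (real (card J) * (1 - 1 / 2 ^ c)) * (1 - 1 / 2 ^ c) ^ t"
      by (intro mult_right_mono mult_left_mono) auto
    also have "\<dots> < 1" using Suc.prems(5) by (simp add: mult_ac)
    finally have small_J: "real (card I) * real (card (J - J1)) * (1 - 1 / 2 ^ c) ^ t < 1" .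
    let ?N = "\<lambda>i j. ?f i j + of_bool v * (-1)"
    have "rank_le (Suc k) ?N I J"
      by (rule rank_le_add_outer[OF Suc.prems(3)])
    from rank_le_zero_block[OF this R(1,2)] obtain k1 k2
      where k: "k1 + k2 \<le> Suc k" "rank_le k1 ?N I1 J" "rank_le k2 ?N I J1"
      using R(3) by auto
    have k1: "rank_le (Suc k1) ?f I1 J"
      using rank_le_add_outer[OF k(2), of "\<lambda>_. of_bool v" "\<lambda>_. 1"] by simp
    have k2: "rank_le (Suc k2) ?f I J1"
      using rank_le_add_outer[OF k(3), of "\<lambda>_. of_bool v" "\<lambda>_. 1"] by simp
    consider "Suc k1 \<le> (k + 3) div 2" | "Suc k2 \<le> (k + 3) div 2"
      using k(1) by linarith
    then show ?thesis
    proof cases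
      case 1
      have "low_rank_labels t ((k + 3) div 2) ?f (I - I1) J"
      proof (rule Suc.IH[OF _ Suc.prems(2) _ _ small_I])
        show "rank_le k ?f (I - I1) J" by (rule rank_le_mono[OF Suc.prems(3)]) auto
        show "large_mono_rect c f I' J'" if "I' \<subseteq> I - I1" "J' \<subseteq> J" for I' J'
          using that by (intro Suc.prems(4)) auto
      qed (use Suc.prems(1) in auto)
      moreover have "rank_le ((k + 3) div 2) ?f I1 J" by (rule rank_le_mono[OF k1 1]) auto
      ultimately show ?thesis by (rule low_rank_labels_extend[rotated])
    next
      case 2
      have "low_rank_labels t ((k + 3) div 2) ?f I (J - J1)"
      proof (rule Suc.IH[OF Suc.prems(1) _ _ _ small_J])
        show "rank_le k ?f I (J - J1)" by (rule rank_le_mono[OF Suc.prems(3)]) auto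
        show "large_mono_rect c f I' J'" if "I' \<subseteq> I" "J' \<subseteq> J - J1" for I' J'
          using that by (intro Suc.prems(4)) auto
      qed (use Suc.prems(2) in auto)
      moreover have "rank_le ((k + 3) div 2) ?f I J1" by (rule rank_le_mono[OF k2 2]) auto
      ultimately have "low_rank_labels (Suc t) ((k + 3) div 2) (\<lambda>j i. ?f i j) J I"
        using low_rank_labels_extend[of "(k + 3) div 2" "\<lambda>j i. ?f i j" J1 I t J]
          low_rank_labels_transpose rank_le_transpose by blast
      then show ?thesis by (drule_tac low_rank_labels_transpose) simp
    qed
  qed (rule low_rank_labels_empty)
qed

text \<open>The map from \<open>k\<close> to \<open>(k + 3) div 2\<close> halves the excess over 3,
  so after \<open>s\<close> rounds the rank is at most 4 and 5 bits finish. In each round both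
  players send a label of \<open>q\<close> bits. The same \<open>t\<close> serves all rounds, since
  subrectangles have fewer entries.\<close>

lemma protocol_le_large_mono_rects:
  assumes fin: "finite I" "finite J"
    and rects: "\<And>I' J'. I' \<subseteq> I \<Longrightarrow> J' \<subseteq> J \<Longrightarrow> large_mono_rect c f I' J'"
    and t: "real (card I) * real (card J) * (1 - 1 / 2 ^ c) ^ t < 1" "t < 2 ^ q"
    and "I' \<subseteq> I" "J' \<subseteq> J" "rank_le k (\<lambda>i j. of_bool (f i j)) I' J'" "k \<le> 2 ^ s + 3"
  shows "protocol_le (2 * q * s + 5) f I' J'"
  using assms(6-)
proof (induction s arbitrary: k I' J')
  case 0
  show ?case by (rule protocol_le_mono[OF protocol_le_rank_le[OF 0(3)]]) (use 0 in auto)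
next
  case (Suc s)
  have fin': "finite I'" "finite J'" using fin Suc.prems finite_subset by auto
  have "real (card I') * real (card J') * (1 - 1 / 2 ^ c) ^ t \<le> real (card I) * real (card J) * (1 - 1 / 2 ^ c) ^ t"
    using fin Suc.prems(1,2) by (intro mult_right_mono mult_mono) (auto intro: card_mono)
  also note t(1)
  finally have small: "real (card I') * real (card J') * (1 - 1 / 2 ^ c) ^ t < 1" .
  have "low_rank_labels t ((k + 3) div 2) (\<lambda>i j. of_bool (f i j)) I' J'"
    using Suc.prems rects by (intro low_rank_labels_halving[OF fin' _ _ small]) auto
  then obtain \<alpha> \<beta> where ab: "\<And>x. \<alpha> x \<le> t" "\<And>y. \<beta> y \<le> t"
    "\<And>m n. rank_le ((k + 3) div 2) (\<lambda>i j. of_bool (f i j)) {x\<in>I'. \<alpha> x = m} {y\<in>J'. \<beta> y = n}"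
    unfolding low_rank_labels_def by blast
  have lt: "\<alpha> x < 2 ^ q" "\<beta> x < 2 ^ q" for x
    using ab(1,2)[of x] t(2) by linarith+
  have "protocol_le (2 * q * s + 5) f {x\<in>I'. \<alpha> x = m} {y\<in>J'. \<beta> y = n}" for m n
    using Suc.prems by (intro Suc.IH[OF _ _ ab(3)]) auto
  then have "protocol_le (2 * q * s + 5 + q) f {x\<in>I'. \<alpha> x = m} J'" for m
    by (rule protocol_le_bob_number) (rule lt)
  then have "protocol_le (2 * q * s + 5 + q + q) f I' J'"
    by (rule protocol_le_alice_number) (rule lt)
  then show ?case by (simp add: algebra_simps)
qed

section \<open>Point-hyperplane configurations\<close>

lemma finite_rs_values:
  assumes "finite P" "finite H"
  shows "finite {card {p\<in>P. p \<in> S} * card {h\<in>H. S \<subseteq> hplane d h} | S. affine_subspace d S}"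
proof (rule finite_subset)
  have "card {p\<in>P. p \<in> S} * card {h\<in>H. S \<subseteq> hplane d h} \<le> card P * card H" for S
    using assms by (intro mult_le_mono card_mono) auto
  then show "{card {p\<in>P. p \<in> S} * card {h\<in>H. S \<subseteq> hplane d h} | S. affine_subspace d S}
    \<subseteq> {..card P * card H}" by auto
qed simp

lemma rs_ge:
  assumes "finite P" "finite H" "affine_subspace d S"
  shows "card {p\<in>P. p \<in> S} * card {h\<in>H. S \<subseteq> hplane d h} \<le> rs d P H"
  unfolding rs_def using finite_rs_values[OF assms(1,2)] assms(3) by (intro Max_ge) auto

lemma rs_attained:
  assumes "finite P" "finite H"
  obtains S where "affine_subspace d S"
    "rs d P H = card {p\<in>P. p \<in> S} * card {h\<in>H. S \<subseteq> hplane d h}"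
proof -
  \<comment> \<open>The empty set counts as an affine subspace, so the maximum is over a nonempty
    set.\<close>
  have "affine_subspace d {}" by (simp add: affine_subspace_def)
  then have "rs d P H \<in> {card {p\<in>P. p \<in> S} * card {h\<in>H. S \<subseteq> hplane d h} | S. affine_subspace d S}"
    unfolding rs_def using finite_rs_values[OF assms] by (intro Max_in) auto
  then show ?thesis using that by auto
qed

lemma ip_affine_combination:
  "ip d u (\<lambda>i. (1 - t) * x i + t * y i) = (1 - t) * ip d u x + t * ip d u y"
proof -
  have "ip d u (\<lambda>i. (1 - t) * x i + t * y i) = (\<Sum>i<d. (1 - t) * (u i * x i) + t * (u i * y i))"
    unfolding ip_def by (rule sum.cong) (auto simp: algebra_simps)
  then show ?thesis by (simp add: ip_def sum.distrib sum_distrib_left)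
qed

lemma affine_subspace_solutions:
  "affine_subspace d {x \<in> Rd d. \<forall>k\<in>K. ip d (u k) x = w k}"
  unfolding affine_subspace_def
proof (intro conjI ballI allI)
  fix x y t
  assume x: "x \<in> {x \<in> Rd d. \<forall>k\<in>K. ip d (u k) x = w k}"
    and y: "y \<in> {x \<in> Rd d. \<forall>k\<in>K. ip d (u k) x = w k}"
  then have "(1 - t) * ip d (u k) x + t * ip d (u k) y = w k" if "k \<in> K" for k
    using that by (simp add: algebra_simps)
  then show "(\<lambda>i. (1 - t) * x i + t * y i) \<in> {x \<in> Rd d. \<forall>k\<in>K. ip d (u k) x = w k}"
    using x y by (auto simp: ip_affine_combination Rd_def)
qed auto

text \<open>Rows are the blocks and columns the points; the entry is the offset of the hyperplane of
  the block that contains the point. Inner products with the common normals show that the rank is at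
  most \<open>d\<close>. A monochromatic rectangle of value \<open>v\<close> yields the subspace cut
  out by the hyperplanes of offset \<open>v\<close> in its blocks. The additional factor of 2 comes
  from blocks with two hyperplanes.\<close>

lemma rs_ge_of_protocols:
  assumes conf: "configuration d P H" and part: "parallel_partition 2 d P H" and offs: "offsets H = {0, 1}"
    and protocols: "\<And>a b f. rank01 a b f \<le> d \<Longrightarrow> protocol_le c f {..<a} {..<b}"
  shows "card H * card P \<le> rs d P H * 2 ^ Suc c"
proof -
  have fin: "finite P" "finite H" and PR: "P \<subseteq> Rd d" using conf by (auto simp: configuration_def)
  obtain Bs where Bs: "partition_on H Bs"
    and "\<forall>B\<in>Bs. card B \<le> 2 \<and> (\<forall>h\<in>B. \<forall>h'\<in>B. fst h = fst h') \<and> (\<forall>p\<in>P. \<exists>h\<in>B. p \<in> hplane d h)"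
    using part unfolding parallel_partition_def by (elim exE conjE)
  then have blocks: "\<And>B. B \<in> Bs \<Longrightarrow> card B \<le> 2"
      "\<And>B h h'. B \<in> Bs \<Longrightarrow> h \<in> B \<Longrightarrow> h' \<in> B \<Longrightarrow> fst h = fst h'"
      "\<And>B p. B \<in> Bs \<Longrightarrow> p \<in> P \<Longrightarrow> \<exists>h\<in>B. p \<in> hplane d h"
    by metis+
  have finBs: "finite Bs" using finite_elements[OF fin(2) Bs] .
  have HU: "H = \<Union>Bs" and dis: "disjoint Bs" using Bs by (auto simp: partition_on_def)
  have "card H \<le> (\<Sum>B\<in>Bs. card B)" unfolding HU by (rule card_Union_le_sum_card)
  also have "\<dots> \<le> (\<Sum>B\<in>Bs. 2)" by (intro sum_mono blocks(1))
  finally have cardH: "card H \<le> 2 * card Bs" by simp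
  define nv where "nv = (\<lambda>B :: ((nat \<Rightarrow> real) \<times> real) set. fst (SOME h. h \<in> B))"
  have nv: "fst h = nv B" if "B \<in> Bs" "h \<in> B" for B h
    unfolding nv_def using blocks(2)[OF that] someI[of "\<lambda>h. h \<in> B", OF that(2)] by blast
  have key: "(nv B, ip d (nv B) p) \<in> B" "ip d (nv B) p \<in> {0, 1}" if B: "B \<in> Bs" and p: "p \<in> P" for B p
  proof -
    obtain h where h: "h \<in> B" "p \<in> hplane d h" using blocks(3)[OF B p] by blast
    then have *: "ip d (nv B) p = snd h" using nv[OF B h(1)] by (simp add: hplane_def)
    then show "(nv B, ip d (nv B) p) \<in> B"
      using h(1) nv[OF B h(1)] by (metis prod.collapse)
    have "h \<in> H" using h(1) B HU by blast
    then show "ip d (nv B) p \<in> {0, 1}" using offs * unfolding offsets_def by blast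
  qed
  obtain eB where eB: "bij_betw eB {..<card Bs} Bs"
    using ex_bij_betw_nat_finite[OF finBs] by (auto simp: atLeast0LessThan)
  obtain eP where eP: "bij_betw eP {..<card P} P"
    using ex_bij_betw_nat_finite[OF fin(1)] by (auto simp: atLeast0LessThan)
  have eB_in: "eB i \<in> Bs" if "i < card Bs" for i using bij_betwE[OF eB] that by blast
  have eP_in: "eP j \<in> P" if "j < card P" for j using bij_betwE[OF eP] that by blast
  define f where "f = (\<lambda>i j. ip d (nv (eB i)) (eP j) = 1)"
  have f: "of_bool (f i j) = ip d (nv (eB i)) (eP j)" if "i < card Bs" "j < card P" for i j
    using key(2)[OF eB_in[OF that(1)] eP_in[OF that(2)]] by (auto simp: f_def)
  have "rank_le d (\<lambda>i j. of_bool (f i j)) {..<card Bs} {..<card P}"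
    by (rule rank_leI[of "{..<d}" _ _ _ _ "\<lambda>i. nv (eB i)" "\<lambda>l j. eP j l"]) (auto simp: f ip_def)
  then have "protocol_le c f {..<card Bs} {..<card P}"
    by (intro protocols rank01_le)
  then have "large_mono_rect c f {..<card Bs} {..<card P}"
    unfolding protocol_le_def by (auto intro: protocol_large_mono_rect)
  then obtain I1 J1 v where R: "I1 \<subseteq> {..<card Bs}" "J1 \<subseteq> {..<card P}" "\<forall>i\<in>I1. \<forall>j\<in>J1. f i j = v"
    and size: "card Bs * card P \<le> card I1 * card J1 * 2 ^ c"
    unfolding large_mono_rect_def by auto
  have "card I1 * card J1 \<le> rs d P H"
  proof (cases "J1 = {}")
    case False
    then obtain j1 where j1: "j1 \<in> J1" by blast
    define S where "S = {x \<in> Rd d. \<forall>i\<in>I1. ip d (nv (eB i)) x = of_bool v}"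
    have ipv: "ip d (nv (eB i)) (eP j) = of_bool v" if "i \<in> I1" "j \<in> J1" for i j
    proof -
      have "i < card Bs" "j < card P" "f i j = v" using R that by auto
      then show ?thesis using f[of i j] by simp
    qed
    \<comment> \<open>A block may be a single hyperplane; the point of \<open>j1\<close> witnesses
      that the offset \<open>v\<close> occurs in it.\<close>
    have block: "(nv (eB i), of_bool v) \<in> eB i" if "i \<in> I1" for i
      using key(1)[of "eB i" "eP j1"] ipv[OF that j1] R that j1 eB_in eP_in by (metis lessThan_iff subsetD)
    have "eP ` J1 \<subseteq> {p\<in>P. p \<in> S}"
      using ipv R(2) eP_in PR by (auto simp: S_def subset_iff)
    moreover have "card (eP ` J1) = card J1"
      by (rule card_image, rule inj_on_subset[OF bij_betw_imp_inj_on[OF eP] R(2)])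
    ultimately have P1: "card J1 \<le> card {p\<in>P. p \<in> S}"
      using card_mono[of "{p\<in>P. p \<in> S}" "eP ` J1"] fin by simp
    \<comment> \<open>Different blocks may have the same normal, but a hyperplane common to both
      would contradict disjointness.\<close>
    have "inj_on (\<lambda>i. (nv (eB i), of_bool v :: real)) I1"
    proof (rule inj_onI)
      fix i i' assume i: "i \<in> I1" "i' \<in> I1"
        and eq: "(nv (eB i), of_bool v :: real) = (nv (eB i'), of_bool v)"
      have "eB i \<inter> eB i' \<noteq> {}" using block[OF i(1)] block[OF i(2)] eq by auto
      then have "eB i = eB i'"
        using dis eB_in R(1) i unfolding disjoint_def by (metis lessThan_iff subsetD)
      then show "i = i'" using bij_betw_imp_inj_on[OF eB] R(1) i by (meson inj_onD subsetD)
    qed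
    then have "card ((\<lambda>i. (nv (eB i), of_bool v :: real)) ` I1) = card I1" by (rule card_image)
    moreover have "(\<lambda>i. (nv (eB i), of_bool v :: real)) ` I1 \<subseteq> {h\<in>H. S \<subseteq> hplane d h}"
    proof (intro image_subsetI CollectI conjI)
      fix i assume i: "i \<in> I1"
      then show "(nv (eB i), of_bool v) \<in> H"
        using block[OF i] eB_in[of i] R(1) HU by blast
      show "S \<subseteq> hplane d (nv (eB i), of_bool v)"
        using i by (auto simp: S_def hplane_def)
    qed
    ultimately have H1: "card I1 \<le> card {h\<in>H. S \<subseteq> hplane d h}"
      using card_mono[of "{h\<in>H. S \<subseteq> hplane d h}" "(\<lambda>i. (nv (eB i), of_bool v :: real)) ` I1"] fin by simp
    have "card I1 * card J1 \<le> card {p\<in>P. p \<in> S} * card {h\<in>H. S \<subseteq> hplane d h}"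
      using mult_le_mono[OF P1 H1] by (simp add: mult.commute)
    also have "\<dots> \<le> rs d P H"
      unfolding S_def by (rule rs_ge[OF fin affine_subspace_solutions])
    finally show ?thesis .
  qed simp
  then have "card I1 * card J1 * 2 ^ c \<le> rs d P H * 2 ^ c" by simp
  with size have "card Bs * card P \<le> rs d P H * 2 ^ c" by linarith
  moreover have "card H * card P \<le> 2 * (card Bs * card P)"
    using mult_le_mono1[OF cardH, of "card P"] by (simp add: mult.assoc)
  ultimately show ?thesis unfolding power_Suc by linarith
qed

text \<open>Three extra coordinates make the hyperplanes and the points pairwise distinct without
  affecting the inner products: the normal of row \<open>i\<close> is extended by \<open>(i, 1, 0)\<close> and the point of
  column \<open>j\<close> by \<open>(0, 0, j)\<close>, so that repeated or vanishing rows and columns do no harm.\<close>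

lemma large_mono_rect_of_rs:
  fixes f :: "nat \<Rightarrow> nat \<Rightarrow> bool"
  assumes fin: "finite I" "finite J" and rank: "rank_le r (\<lambda>i j. of_bool (f i j)) I J"
    and rs: "\<And>P H. configuration (r + 3) P H \<Longrightarrow> parallel_partition 2 (r + 3) P H \<Longrightarrow>
      offsets H = {0, 1} \<Longrightarrow> card H * card P \<le> rs (r + 3) P H * 2 ^ c"
  shows "large_mono_rect c f I J"
proof (cases "I = {} \<or> J = {}")
  case False
  obtain u v :: "nat \<Rightarrow> nat \<Rightarrow> real"
    where uv: "\<And>i j. i \<in> I \<Longrightarrow> j \<in> J \<Longrightarrow> of_bool (f i j) = (\<Sum>l<r. u i l * v l j)"
    using rank by (auto simp: rank_le_def)
  let ?d = "r + 3"
  define nv :: "nat \<Rightarrow> nat \<Rightarrow> real" where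
    "nv = (\<lambda>i l. if l < r then u i l else if l = r then real i else if l = r + 1 then 1 else 0)"
  define pt :: "nat \<Rightarrow> nat \<Rightarrow> real" where
    "pt = (\<lambda>j l. if l < r then v l j else if l = r + 2 then real j else 0)"
  have ip_split: "ip ?d x y = (\<Sum>l<r. x l * y l) + x r * y r + x (r + 1) * y (r + 1) + x (r + 2) * y (r + 2)"
    for x y by (simp add: ip_def eval_nat_numeral)
  have ip_pt: "ip ?d (nv i) (pt j) = of_bool (f i j)" if "i \<in> I" "j \<in> J" for i j
    unfolding ip_split uv[OF that] by (simp add: nv_def pt_def)
  have in_Rd: "nv i \<in> Rd ?d" "pt j \<in> Rd ?d" for i j by (auto simp: Rd_def nv_def pt_def)
  have inj_pt: "inj pt"
    by (rule injI) (auto simp: pt_def fun_eq_iff dest!: spec[of _ "r + 2"])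
  \<comment> \<open>These test points see only the coordinates \<open>r\<close> and
    \<open>r + 1\<close>, where the normal is \<open>(i, 1)\<close>. Membership of
    \<open>probe 0 b\<close> reveals the offset of a hyperplane and that of
    \<open>probe 1 (b - real i)\<close> its row, so hyperplanes are distinct as sets.\<close>
  define probe :: "real \<Rightarrow> real \<Rightarrow> nat \<Rightarrow> real" where
    "probe = (\<lambda>s t l. if l = r then s else if l = r + 1 then t else 0)"
  have probe: "probe s t \<in> hplane ?d (nv i, b) \<longleftrightarrow> real i * s + t = b" for s t i b
  proof -
    have "(\<Sum>l<r. nv i l * probe s t l) = 0" by (intro sum.neutral) (auto simp: probe_def)
    then show ?thesis
      by (auto simp: hplane_def ip_split) (auto simp: probe_def nv_def Rd_def)
  qed
  have inj_hplane: "i = i' \<and> b = b'" if eq: "hplane ?d (nv i, b) = hplane ?d (nv i', b')" for i i' b b'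
  proof -
    have "b = b'" using probe[of 0 b i b] probe[of 0 b i' b'] eq by simp
    moreover have "real i' + (b - real i) = b'"
      using probe[of 1 "b - real i" i b] probe[of 1 "b - real i" i' b'] eq by simp
    ultimately show ?thesis by simp
  qed
  define P where "P = pt ` J"
  define H where "H = (\<lambda>(i, b). (nv i, b)) ` (I \<times> {0, 1 :: real})"
  have inj_nv: "inj_on (\<lambda>(i, b). (nv i, b)) (I \<times> {0, 1 :: real})"
    using inj_hplane by (auto simp: inj_on_def)
  have cardP: "card P = card J" unfolding P_def using inj_pt by (meson card_image inj_on_subset subset_UNIV)
  have cardH: "card H = 2 * card I"
    unfolding H_def card_image[OF inj_nv] by (simp add: card_cartesian_product)
  have "configuration ?d P H"
    unfolding configuration_def
  proof (intro conjI ballI)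
    show "inj_on (hplane ?d) H" by (auto simp: inj_on_def H_def dest: inj_hplane)
    show "fst h \<noteq> (\<lambda>_. 0)" if "h \<in> H" for h
      using that by (auto simp: H_def nv_def fun_eq_iff intro!: exI[of _ "r + 1"])
  qed (use fin in_Rd in \<open>auto simp: P_def H_def\<close>)
  moreover have "parallel_partition 2 ?d P H"
    unfolding parallel_partition_def
  proof (intro exI[of _ "(\<lambda>i. {(nv i, 0), (nv i, 1)}) ` I"] conjI ballI)
    show "partition_on H ((\<lambda>i. {(nv i, 0), (nv i, 1)}) ` I)"
      by (rule partition_onI) (auto simp: H_def disjnt_def)
    fix B assume "B \<in> (\<lambda>i. {(nv i, 0 :: real), (nv i, 1)}) ` I"
    then obtain i where i: "i \<in> I" and B: "B = {(nv i, 0), (nv i, 1)}" by blast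
    show "card B \<le> 2" unfolding B by (simp add: card_insert_if)
    show "fst h = fst h'" if "h \<in> B" "h' \<in> B" for h h' using that B by auto
    show "\<exists>h\<in>B. p \<in> hplane ?d h" if p: "p \<in> P" for p
    proof -
      obtain j where j: "j \<in> J" "p = pt j" using p P_def by blast
      then have "p \<in> hplane ?d (nv i, of_bool (f i j))"
        using ip_pt[OF i j(1)] in_Rd by (simp add: hplane_def)
      then show ?thesis unfolding B by (cases "f i j") auto
    qed
  qed
  moreover have "offsets H = {0, 1}" using False by (force simp: offsets_def H_def)
  ultimately have bound: "2 * card I * card J \<le> rs ?d P H * 2 ^ c" using rs[of P H] cardP cardH by simp
  have finPH: "finite P" "finite H" using fin by (auto simp: P_def H_def)
  obtain S where S: "rs ?d P H = card {p\<in>P. p \<in> S} * card {h\<in>H. S \<subseteq> hplane ?d h}"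
    using rs_attained[OF finPH] by blast
  define J1 where "J1 = {j\<in>J. pt j \<in> S}"
  define I1 where "I1 = (\<lambda>b::bool. {i\<in>I. S \<subseteq> hplane ?d (nv i, of_bool b)})"
  have "{p\<in>P. p \<in> S} = pt ` J1" by (auto simp: P_def J1_def)
  then have cJ: "card {p\<in>P. p \<in> S} = card J1"
    using inj_pt by (metis card_image inj_on_subset subset_UNIV)
  have split: "{h\<in>H. S \<subseteq> hplane ?d h} = (\<lambda>i. (nv i, 0)) ` I1 False \<union> (\<lambda>i. (nv i, 1)) ` I1 True"
    by (auto simp: H_def I1_def)
  have "card {h\<in>H. S \<subseteq> hplane ?d h}
      \<le> card ((\<lambda>i. (nv i, 0::real)) ` I1 False) + card ((\<lambda>i. (nv i, 1::real)) ` I1 True)"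
    unfolding split by (rule card_Un_le)
  also have "\<dots> \<le> card (I1 False) + card (I1 True)"
    using fin by (intro add_mono card_image_le) (auto simp: I1_def)
  \<comment> \<open>The larger of the two offset classes is kept; the loss of a factor 2 is offset
    by \<open>card H = 2 * card I\<close>.\<close>
  finally have "card {h\<in>H. S \<subseteq> hplane ?d h} \<le> 2 * card (I1 (card (I1 False) \<le> card (I1 True)))"
    by (cases "card (I1 False) \<le> card (I1 True)") auto
  then obtain b where b: "card {h\<in>H. S \<subseteq> hplane ?d h} \<le> 2 * card (I1 b)" by blast
  have "2 * card I * card J \<le> card J1 * (2 * card (I1 b)) * 2 ^ c"
    using bound mult_le_mono1[OF mult_le_mono2[OF b, of "card J1"], of "2 ^ c"]
    unfolding S cJ by linarith
  then have "card I * card J \<le> card (I1 b) * card J1 * 2 ^ c" by (simp add: mult_ac)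
  moreover have "f i j = b" if "i \<in> I1 b" "j \<in> J1" for i j
  proof -
    have "pt j \<in> hplane ?d (nv i, of_bool b)" using that by (auto simp: I1_def J1_def)
    then have "(of_bool (f i j) :: real) = of_bool b"
      using ip_pt[of i j] that by (simp add: hplane_def I1_def J1_def)
    then show ?thesis by (simp add: of_bool_eq_iff)
  qed
  moreover have "I1 b \<subseteq> I" "J1 \<subseteq> J" by (auto simp: I1_def J1_def)
  ultimately show ?thesis
    unfolding large_mono_rect_def
    by (intro exI[of _ "I1 b"] exI[of _ J1] conjI exI[of _ b]) auto
qed (rule large_mono_rect_empty)

text \<open>A row is determined by its pattern on at most \<open>k\<close> columns, so there are at
  most \<open>2 ^ k\<close> different rows; \<open>p\<close> chooses one index for each
  pattern.\<close>

lemma rank_le_row_representatives: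
  assumes "rank_le k (\<lambda>i j. of_bool (f i j)) I J"
  shows "\<exists>p. p ` I \<subseteq> I \<and> finite (p ` I) \<and> card (p ` I) \<le> 2 ^ k \<and> (\<forall>x\<in>I. \<forall>y\<in>J. f (p x) y = f x y)"
proof -
  obtain J0 where J0: "J0 \<subseteq> J" "finite J0" "card J0 \<le> k"
    and det: "\<forall>i\<in>I. \<forall>i'\<in>I. (\<forall>j\<in>J0. f i j = f i' j) \<longrightarrow> (\<forall>j\<in>J. f i j = f i' j)"
    using rank_le_determining_columns[OF assms] by (auto simp: of_bool_eq_iff)
  define row where "row = (\<lambda>x. {j\<in>J0. f x j})"
  define rep where "rep = (\<lambda>s. SOME x. x \<in> I \<and> row x = s)"
  have rep: "rep (row x) \<in> I \<and> row (rep (row x)) = row x" if "x \<in> I" for x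
    unfolding rep_def by (rule someI[of _ x]) (use that in simp)
  have rows: "row ` I \<subseteq> Pow J0" by (auto simp: row_def)
  have finrow: "finite (row ` I)" using rows J0(2) finite_subset by blast
  have "card (rep ` row ` I) \<le> card (row ` I)" by (rule card_image_le[OF finrow])
  also have "\<dots> \<le> card (Pow J0)" using rows J0(2) by (intro card_mono) auto
  also have "\<dots> \<le> 2 ^ k" using J0 by (simp add: card_Pow)
  finally have "card (rep ` row ` I) \<le> 2 ^ k" .
  moreover have "f (rep (row x)) y = f x y" if "x \<in> I" "y \<in> J" for x y
  proof -
    have "\<forall>j\<in>J0. f (rep (row x)) j = f x j"
      using rep[OF that(1)] unfolding row_def by blast
    then show ?thesis using det rep[OF that(1)] that by blast
  qed
  ultimately show ?thesis
    using rep finite_imageI[OF finrow, of rep]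
    by (intro exI[of _ "\<lambda>x. rep (row x)"]) (auto simp: image_image)
qed

text \<open>Passing to representatives of equal rows and columns bounds the number of entries by
  \<open>2 ^ (2 * r)\<close>, which makes the number of peeling steps depend on \<open>r\<close> and
  \<open>c\<close> only.\<close>

lemma protocol_le_of_large_mono_rects:
  assumes rank: "rank_le r (\<lambda>i j. of_bool (f i j)) I J" and r: "1 \<le> r" "r \<le> 2 ^ L"
    and rects: "\<And>I' J'. finite I' \<Longrightarrow> finite J' \<Longrightarrow> I' \<subseteq> I \<Longrightarrow> J' \<subseteq> J \<Longrightarrow> large_mono_rect c f I' J'"
  shows "protocol_le (2 * (c + L + 2) * L + 5) f I J"
proof -
  obtain p where p: "p ` I \<subseteq> I" "finite (p ` I)" "card (p ` I) \<le> 2 ^ r"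
    "\<forall>x\<in>I. \<forall>y\<in>J. f (p x) y = f x y"
    using rank_le_row_representatives[OF rank] by (elim exE conjE)
  obtain q where q: "q ` J \<subseteq> J" "finite (q ` J)" "card (q ` J) \<le> 2 ^ r"
    "\<forall>y\<in>J. \<forall>x\<in>I. f x (q y) = f x y"
    using rank_le_row_representatives[of r "\<lambda>j i. f i j", OF rank_le_transpose[OF rank]] by (elim exE conjE)
  \<comment> \<open>With this \<open>t\<close>, the shrinking factor is at most
    \<open>exp (- (2 * real r))\<close>, which beats the number of entries.\<close>
  define t where "t = 2 * r * 2 ^ c"
  have "(1 - 1 / 2 ^ c :: real) \<le> exp (- (1 / 2 ^ c))"
    using exp_ge_add_one_self[of "- (1 / 2 ^ c)"] by simp
  then have "(1 - 1 / 2 ^ c :: real) ^ t \<le> exp (- (1 / 2 ^ c)) ^ t"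
    by (intro power_mono) auto
  also have "\<dots> = exp (- (2 * real r))"
    by (simp add: exp_of_nat_mult[symmetric] t_def)
  also have "\<dots> = (1 / exp 1) ^ (2 * r)"
    using exp_of_nat_mult[of "2 * r" "-1::real"] by (simp add: exp_minus inverse_eq_divide)
  also have "\<dots> < (1 / 2) ^ (2 * r)"
  proof (rule power_strict_mono)
    \<comment> \<open>The bound used is \<open>(1 + 1 / 2) ^ 2 = 9 / 4\<close>.\<close>
    have "(2::real) < exp 1" using exp_ge_one_plus_x_over_n_power_n[of 2 1] by (simp add: power2_eq_square)
    then show "1 / exp 1 < (1 / 2 :: real)" by (simp add: field_simps)
  qed (use r in auto)
  finally have decay: "(1 - 1 / 2 ^ c :: real) ^ t < (1 / 2) ^ (2 * r)" .
  have "real (card (p ` I)) * real (card (q ` J)) \<le> 2 ^ r * 2 ^ r"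
    using of_nat_mono[OF p(3), where ?'a = real] of_nat_mono[OF q(3), where ?'a = real]
    by (intro mult_mono) auto
  then have "real (card (p ` I)) * real (card (q ` J)) * (1 - 1 / 2 ^ c) ^ t \<le> 2 ^ r * 2 ^ r * (1 - 1 / 2 ^ c) ^ t"
    by (intro mult_right_mono) auto
  also have "\<dots> < 2 ^ r * 2 ^ r * (1 / 2) ^ (2 * r)"
    using decay by simp
  also have "\<dots> = 1" by (simp add: power_mult power2_eq_square power_mult_distrib[symmetric] flip: power_add mult_2)
  finally have small: "real (card (p ` I)) * real (card (q ` J)) * (1 - 1 / 2 ^ c) ^ t < 1" .
  have "t \<le> 2 * 2 ^ L * 2 ^ c" unfolding t_def using r(2) by simp
  also have "\<dots> < 2 ^ (c + L + 2)" by (simp add: power_add)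
  finally have tq: "t < 2 ^ (c + L + 2)" .
  have "protocol_le (2 * (c + L + 2) * L + 5) f (p ` I) (q ` J)"
  proof (rule protocol_le_large_mono_rects[OF p(2) q(2) _ small tq order_refl order_refl])
    show "large_mono_rect c f A B" if "A \<subseteq> p ` I" "B \<subseteq> q ` J" for A B
      using that p(1,2) q(1,2) by (intro rects) (auto intro: finite_subset)
    show "rank_le r (\<lambda>i j. of_bool (f i j)) (p ` I) (q ` J)" by (rule rank_le_mono[OF rank order_refl p(1) q(1)])
    show "r \<le> 2 ^ L + 3" using r(2) by simp
  qed
  then have "protocol_le (2 * (c + L + 2) * L + 5) (\<lambda>x y. f (p x) (q y)) I J"
    by (rule protocol_le_comp) auto
  moreover have "f (p x) (q y) = f x y" if "x \<in> I" "y \<in> J" for x y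
    using p(1,4) q(1,4) that by (simp add: image_subset_iff)
  ultimately show ?thesis unfolding protocol_le_def by simp
qed

section \<open>The two implications and their constants\<close>

lemma mult_powr_le_abs:
  fixes C x y :: real
  assumes "1 \<le> x" "x \<le> y"
  shows "C * x powr C \<le> \<bar>C\<bar> * y powr \<bar>C\<bar>"
proof -
  \<comment> \<open>The constant is factor and exponent at once and may be negative; with its
    absolute value in both places the bound is monotone in the base, which is at least 1.\<close>
  have "C * x powr C \<le> \<bar>C\<bar> * x powr C" by (intro mult_right_mono) auto
  also have "\<dots> \<le> \<bar>C\<bar> * x powr \<bar>C\<bar>" using assms by (intro mult_left_mono powr_mono) auto
  also have "\<dots> \<le> \<bar>C\<bar> * y powr \<bar>C\<bar>" using assms by (intro mult_left_mono powr_mono2) auto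
  finally show ?thesis .
qed

lemma point_hyperplane_bound_of_log_rank:
  fixes C :: real
  assumes CC: "\<And>a b f. rank01 a b f \<ge> 2 \<Longrightarrow> real (CC_det a b f) \<le> C * (log 2 (real (rank01 a b f))) powr C"
    and d: "d \<ge> 2"
    and conf: "configuration d P H" "parallel_partition 2 d P H" "offsets H = {0, 1}"
  shows "real (card H) * real (card P) * 2 powr (- (\<bar>C\<bar> + 3) * (log 2 (real d)) powr (\<bar>C\<bar> + 3)) \<le> real (rs d P H)"
proof -
  define l where "l = log 2 (real d)"
  have l: "1 \<le> l" unfolding l_def using d by (simp add: le_log_iff)
  \<comment> \<open>The 2 covers rank at most 1, about which the log-rank bound says nothing.
    Rounding down is harmless as \<open>CC_det\<close> is an integer.\<close>
  define c where "c = max 2 (nat \<lfloor>\<bar>C\<bar> * l powr \<bar>C\<bar>\<rfloor>)"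
  have "protocol_le c f {..<a} {..<b}" if r: "rank01 a b f \<le> d" for a b f
  proof (cases "rank01 a b f \<ge> 2")
    case True
    have "real (CC_det a b f) \<le> \<bar>C\<bar> * l powr \<bar>C\<bar>"
      using CC[OF True] mult_powr_le_abs[of "log 2 (rank01 a b f)" l C] True r
      by (simp add: l_def le_log_iff)
    then have "CC_det a b f \<le> c" unfolding c_def by (simp add: le_max_iff_disj le_nat_floor)
    then show ?thesis by (rule protocol_le_mono[OF protocol_le_CC_det]) auto
  next
    case False
    have "protocol_le (Suc (rank01 a b f)) f {..<a} {..<b}"
      by (rule protocol_le_rank_le[OF rank_le_rank01])
    then show ?thesis by (rule protocol_le_mono) (use False in \<open>auto simp: c_def\<close>)
  qed
  from rs_ge_of_protocols[OF conf this]
  have "real (card H * card P) \<le> real (rs d P H * 2 ^ Suc c)" by (rule of_nat_mono)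
  then have bound: "real (card H) * real (card P) \<le> real (rs d P H) * 2 powr real (Suc c)"
    by (simp only: powr_realpow[OF zero_less_numeral] of_nat_mult of_nat_power of_nat_numeral)
  have "1 \<le> l powr \<bar>C\<bar>" using l by (simp add: ge_one_powr_ge_zero)
  have "real (nat \<lfloor>\<bar>C\<bar> * l powr \<bar>C\<bar>\<rfloor>) \<le> \<bar>C\<bar> * l powr \<bar>C\<bar>" by (rule of_nat_floor) simp
  moreover have "0 \<le> \<bar>C\<bar> * l powr \<bar>C\<bar>" by simp
  \<comment> \<open>The summand 3 absorbs the 2 in the maximum and the additional bit of
    \<open>Suc c\<close>.\<close>
  ultimately have "real (Suc c) \<le> \<bar>C\<bar> * l powr \<bar>C\<bar> + 3"
    unfolding c_def of_nat_Suc of_nat_max by linarith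
  also have "\<dots> \<le> (\<bar>C\<bar> + 3) * l powr \<bar>C\<bar>" using \<open>1 \<le> l powr \<bar>C\<bar>\<close> by (simp add: algebra_simps)
  also have "\<dots> \<le> (\<bar>C\<bar> + 3) * l powr (\<bar>C\<bar> + 3)" using l by (intro mult_left_mono powr_mono) auto
  finally have "real (Suc c) \<le> (\<bar>C\<bar> + 3) * l powr (\<bar>C\<bar> + 3)" .
  then have "2 powr (- (\<bar>C\<bar> + 3) * l powr (\<bar>C\<bar> + 3)) \<le> 2 powr - real (Suc c)"
    by (intro powr_mono) (auto simp: algebra_simps)
  then have "real (card H) * real (card P) * 2 powr (- (\<bar>C\<bar> + 3) * l powr (\<bar>C\<bar> + 3))
      \<le> real (card H) * real (card P) * 2 powr - real (Suc c)"
    by (intro mult_left_mono) auto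
  also have "\<dots> \<le> real (rs d P H) * 2 powr real (Suc c) * 2 powr - real (Suc c)"
    by (intro mult_right_mono bound) auto
  also have "\<dots> = real (rs d P H)" by (simp add: powr_add[symmetric] mult.assoc del: of_nat_Suc)
  finally show ?thesis unfolding l_def .
qed

text \<open>The configuration bound is applied in dimension \<open>r + 3\<close>. The protocol costs
  on the order of \<open>(c + L) * L\<close> bits, where \<open>c\<close> is polylogarithmic in
  \<open>r\<close> and \<open>L\<close> is about \<open>l\<close>.\<close>

lemma log_rank_bound_of_point_hyperplane:
  fixes C :: real
  assumes rs: "\<And>d P H. d \<ge> 2 \<Longrightarrow> configuration d P H \<Longrightarrow> parallel_partition 2 d P H \<Longrightarrow> offsets H = {0, 1} \<Longrightarrow>
      real (card H) * real (card P) * 2 powr (- C * (log 2 (real d)) powr C) \<le> real (rs d P H)"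
    and r: "rank01 a b f \<ge> 2"
  defines "K \<equiv> \<bar>C\<bar> * 3 powr \<bar>C\<bar>"
  shows "real (CC_det a b f) \<le> (4 * K + \<bar>C\<bar> + 25) * (log 2 (real (rank01 a b f))) powr (4 * K + \<bar>C\<bar> + 25)"
proof -
  define r where "r = rank01 a b f"
  define l where "l = log 2 (real r)"
  define x where "x = \<bar>C\<bar> * (log 2 (real (r + 3))) powr \<bar>C\<bar>"
  define c where "c = nat \<lceil>x\<rceil>"
  define L where "L = nat \<lceil>l\<rceil>"
  have r2: "r \<ge> 2" using assms(2) by (simp add: r_def)
  have l: "1 \<le> l" unfolding l_def using r2 by (simp add: le_log_iff)
  have x0: "0 \<le> x" by (simp add: x_def)
  have K0: "0 \<le> K" by (simp add: K_def)
  have rsc: "card H * card P \<le> rs (r + 3) P H * 2 ^ c"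
    if "configuration (r + 3) P H" "parallel_partition 2 (r + 3) P H" "offsets H = {0, 1}" for P H
  proof -
    have "1 \<le> log 2 (real (r + 3))" using r2 by (subst le_log_iff) auto
    then have "C * (log 2 (real (r + 3))) powr C \<le> x"
      unfolding x_def by (intro mult_powr_le_abs) auto
    also have "x \<le> real c" using x0 by (simp add: c_def)
    finally have "2 powr (- real c) \<le> 2 powr (- C * (log 2 (real (r + 3))) powr C)" by (intro powr_mono) auto
    then have "real (card H) * real (card P) * 2 powr (- real c)
       \<le> real (card H) * real (card P) * 2 powr (- C * (log 2 (real (r + 3))) powr C)"
      by (intro mult_left_mono) auto
    also have "\<dots> \<le> real (rs (r + 3) P H)" using that by (intro rs) auto
    finally have "real (card H) * real (card P) \<le> real (rs (r + 3) P H) * 2 ^ c"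
      by (simp add: powr_minus powr_realpow field_simps)
    then have "real (card H * card P) \<le> real (rs (r + 3) P H * 2 ^ c)" by simp
    then show ?thesis by (simp only: of_nat_le_iff)
  qed
  have rank: "rank_le r (\<lambda>i j. of_bool (f i j)) {..<a} {..<b}"
    unfolding r_def by (rule rank_le_rank01)
  have "real r = 2 powr l" unfolding l_def using r2 by simp
  also have "\<dots> \<le> 2 powr real L" using l by (intro powr_mono) (auto simp: L_def)
  also have "\<dots> = real (2 ^ L)" by (simp add: powr_realpow)
  finally have rL: "r \<le> 2 ^ L" by (simp only: of_nat_le_iff)
  have "large_mono_rect c f I' J'"
    if "finite I'" "finite J'" "I' \<subseteq> {..<a}" "J' \<subseteq> {..<b}" for I' J'
    by (rule large_mono_rect_of_rs[OF that(1,2) rank_le_mono[OF rank order_refl that(3,4)] rsc])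
  moreover have "1 \<le> r" using r2 by simp
  ultimately have "protocol_le (2 * (c + L + 2) * L + 5) f {..<a} {..<b}"
    by (intro protocol_le_of_large_mono_rects[OF rank _ rL])
  then have "CC_det a b f \<le> 2 * (c + L + 2) * L + 5" by (rule CC_det_le)
  then have "real (CC_det a b f) \<le> real (2 * (c + L + 2) * L + 5)" by (rule of_nat_mono)
  also have "\<dots> = 2 * (real c + real L + 2) * real L + 5" by (simp add: algebra_simps)
  also have "\<dots> \<le> 2 * ((K * l powr \<bar>C\<bar> + 1) + 2 * l + 2) * (2 * l) + 5"
  proof -
    have L: "real L \<le> 2 * l" using l unfolding L_def by linarith
    \<comment> \<open>The three extra dimensions multiply the logarithm by at most 3, which is
      absorbed into \<open>K\<close>.\<close>
    have "real (r + 3) \<le> real r ^ 3"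
    proof -
      have "2 * 2 * r \<le> r * r * r" using r2 by (intro mult_le_mono) auto
      moreover have "r + 3 \<le> 2 * 2 * r" using r2 by simp
      ultimately have "r + 3 \<le> r ^ 3" unfolding power3_eq_cube by (rule order_trans[rotated])
      then show ?thesis by (metis of_nat_le_iff of_nat_power)
    qed
    then have "log 2 (real (r + 3)) \<le> log 2 (real r ^ 3)" using r2 by (subst log_le_cancel_iff) auto
    also have "\<dots> = 3 * l" using r2 by (simp add: l_def log_nat_power)
    finally have "log 2 (real (r + 3)) \<le> 3 * l" .
    then have "x \<le> \<bar>C\<bar> * (3 * l) powr \<bar>C\<bar>"
      unfolding x_def using r2 by (intro mult_left_mono powr_mono2) auto
    also have "\<dots> = K * l powr \<bar>C\<bar>" using l by (simp add: K_def powr_mult)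
    finally have "real c \<le> K * l powr \<bar>C\<bar> + 1" unfolding c_def using x0 by linarith
    with L show ?thesis using l K0 by (intro add_mono mult_mono mult_left_mono) auto
  qed
  \<comment> \<open>Expansion gives \<open>4 * K\<close> from the leading term, and 12, 8 and 5 from
    the terms in \<open>l\<close>, \<open>l * l\<close> and 1, which add up to 25.\<close>
  also have "\<dots> \<le> (4 * K + 25) * l powr (\<bar>C\<bar> + 2)"
  proof -
    have p: "l powr s \<le> l powr (\<bar>C\<bar> + 2)" if "s \<le> \<bar>C\<bar> + 2" for s
      using l that by (intro powr_mono) auto
    have "l powr \<bar>C\<bar> * l = l powr (\<bar>C\<bar> + 1)" using l by (simp add: powr_add)
    then have "K * (l powr \<bar>C\<bar> * l) \<le> K * l powr (\<bar>C\<bar> + 2)" using p K0 by (intro mult_left_mono) auto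
    moreover have "l * l \<le> l powr (\<bar>C\<bar> + 2)" using p[of 2] l by (simp add: powr_numeral power2_eq_square)
    moreover have "l \<le> l powr (\<bar>C\<bar> + 2)" using p[of 1] l by simp
    ultimately show ?thesis using l by (simp add: algebra_simps)
  qed
  \<comment> \<open>Factor and exponent have to be the same number, so both are enlarged to a common
    value.\<close>
  also have "\<dots> \<le> (4 * K + \<bar>C\<bar> + 25) * l powr (4 * K + \<bar>C\<bar> + 25)"
    using l K0 by (intro mult_mono powr_mono) auto
  finally show ?thesis unfolding l_def r_def .
qed

theorem theorem2p5:
  shows "(\<exists>C::real. \<forall>(a::nat) (b::nat) (f::nat \<Rightarrow> nat \<Rightarrow> bool).
             rank01 a b f \<ge> 2 \<longrightarrow>
             real (CC_det a b f) \<le> C * (log 2 (real (rank01 a b f))) powr C)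
     \<longleftrightarrow>
     (\<exists>C::real. \<forall>(d::nat) P H.
             d \<ge> 2 \<longrightarrow> configuration d P H \<longrightarrow> parallel_partition 2 d P H \<longrightarrow>
             offsets H = {0, 1} \<longrightarrow>
             real (rs d P H) \<ge> real (card H) * real (card P) * 2 powr (- C * (log 2 (real d)) powr C))"
    (is "?A \<longleftrightarrow> ?B")
proof
  assume ?A
  then show ?B using point_hyperplane_bound_of_log_rank by meson
next
  assume ?B
  then show ?A using log_rank_bound_of_point_hyperplane by meson
qed

end
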